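(* Let $S$ be a $*$-monoid and let $a,w\in S$. Then the following conditions are equivalent: (i) $a$ is $w$-core invertible. (ii) There exists some $x\in S$ such that $awxa=a$, $xawx=x$, $(awx)^*=awx$, $xawa=a$ and $awx^2=x$. (iii) There exists some $x\in S$ such that $awxa=a$, $xS=aS$ and $Sx=Sa^*$. (iv) There exists some $x\in S$ such that $awxa=a$, ${}^0x={}^0a$ and $x^0=(a^* )^0$. (v) There exists some $x\in S$ such that $awxa=a$, ${}^0x={}^0a$ and $(a^* )^0\subseteq x^0$.
   Context: A $*$-monoid is a semigroup $S$ with identity $1$ and a map $*$ satisfying $(x^* )^*=x$ and $(xy)^*=y^*x^*$ for all $x,y\in S$. For $a,w\in S$, $a$ is $w$-core invertible if there exists $x\in S$ with $awx^2=x$, $xawa=a$ and $(awx)^*=awx$. For $b\in S$, the right annihilator is $b^0=\{(r,s)\in S\times S: br=bs\}$ and the left annihilator is ${}^0b=\{(p,q)\in S\times S: pb=qb\}$. *)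

theory Defs
  imports Main
begin

class star_monoid = monoid_mult +
  fixes star :: "'a \<Rightarrow> 'a"  ("(_\<^sup>\<star>)" [1000] 999)
  assumes star_star: "(x\<^sup>\<star>)\<^sup>\<star> = x"
    and star_mult: "(x * y)\<^sup>\<star> = y\<^sup>\<star> * x\<^sup>\<star>"

definition w_core_invertible :: "'a::star_monoid \<Rightarrow> 'a \<Rightarrow> bool" where
  "w_core_invertible w a \<longleftrightarrow>
    (\<exists>x. a * w * x\<^sup>2 = x \<and> x * a * w * a = a \<and> (a * w * x)\<^sup>\<star> = a * w * x)"

text \<open>The principal right ideal \<open>xS\<close> and left ideal \<open>Sx\<close>, where \<open>S\<close> is the whole type.\<close>

definition right_principal :: "'a::monoid_mult \<Rightarrow> 'a set" where
  "right_principal x = {x * s | s. True}"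

definition left_principal :: "'a::monoid_mult \<Rightarrow> 'a set" where
  "left_principal x = {s * x | s. True}"

text \<open>A monoid need not have a zero, so annihilators are sets of pairs:
  \<open>right_annihilator b\<close> is \<open>b\<close> with superscript 0 on the right,
  \<open>left_annihilator b\<close> is \<open>b\<close> with superscript 0 on the left.\<close>

definition right_annihilator :: "'a::monoid_mult \<Rightarrow> ('a \<times> 'a) set" where
  "right_annihilator b = {(r, s). b * r = b * s}"

definition left_annihilator :: "'a::monoid_mult \<Rightarrow> ('a \<times> 'a) set" where
  "left_annihilator b = {(p, q). p * b = q * b}"

end

theory Submission
  imports Defs
begin

text \<open>The conditions are linked in a cycle (i) to (v) and back, and the same \<open>x\<close>
  serves in all of them. The defining equations make \<open>x\<close> and \<open>a\<close> right
  multiples of each other, and \<open>x\<close> and the adjoint of \<open>a\<close> left multiples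
  of each other (\<open>principal_ideals_of_w_core_inverse\<close>). Equal principal ideals have
  equal annihilators on the opposite side. The return from (v),
  \<open>w_core_inverse_if_annihilators\<close>, is the heart. An equation \<open>p * b = b\<close>
  says that \<open>(p, 1)\<close> lies in the left annihilator of \<open>b\<close>, so annihilator
  conditions carry such equations between \<open>a\<close> and \<open>x\<close>. Carried this way,
  \<open>a * w * x * a = a\<close> and its adjoint yield all three defining equations.\<close>

text \<open>Each hypothesis is substituted into the product to be simplified: writing the last
  \<open>a\<close> as \<open>x * a * w * a\<close> exposes \<open>a * w * x\<^sup>2\<close>, and
  writing the last \<open>x\<close> as \<open>a * w * x\<^sup>2\<close> exposes
  \<open>x * a * w * a\<close>.\<close>

lemma w_core_inverse_identities:
  fixes a w x :: "'a::star_monoid"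
  assumes range: "a * w * x\<^sup>2 = x" and fixed: "x * a * w * a = a"
  shows "a * w * x * a = a" and "x * a * w * x = x"
proof -
  have "a * w * x * a = a * w * x * (x * a * w * a)"
    by (simp only: fixed)
  also have "\<dots> = (a * w * x\<^sup>2) * a * w * a"
    by (simp only: power2_eq_square mult.assoc)
  finally show "a * w * x * a = a"
    by (simp only: range fixed)
  have "x * a * w * x = x * a * w * (a * w * x\<^sup>2)"
    by (simp only: range)
  also have "\<dots> = (x * a * w * a) * w * x\<^sup>2"
    by (simp only: mult.assoc)
  finally show "x * a * w * x = x"
    by (simp only: fixed range)
qed

lemma right_principal_eqI:
  assumes "x = y * s" and "y = x * t"
  shows "right_principal x = right_principal y"
proof -
  have "x * u = y * (s * u)" for u
    by (subst assms(1)) (rule mult.assoc)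
  moreover have "y * u = x * (t * u)" for u
    by (subst assms(2)) (rule mult.assoc)
  ultimately show ?thesis
    unfolding right_principal_def by blast
qed

lemma left_principal_eqI:
  assumes "x = s * y" and "y = t * x"
  shows "left_principal x = left_principal y"
proof -
  have "u * x = (u * s) * y" for u
    by (subst assms(1)) (rule mult.assoc[symmetric])
  moreover have "u * y = (u * t) * x" for u
    by (subst assms(2)) (rule mult.assoc[symmetric])
  ultimately show ?thesis
    unfolding left_principal_def by blast
qed

lemma right_principal_eqE:
  assumes "right_principal x = right_principal y"
  obtains s where "x = y * s"
proof -
  have "x * 1 \<in> right_principal x"
    unfolding right_principal_def by blast
  then show thesis
    using assms that unfolding right_principal_def by auto
qed

lemma left_principal_eqE:
  assumes "left_principal x = left_principal y"
  obtains s where "x = s * y"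
proof -
  have "1 * x \<in> left_principal x"
    unfolding left_principal_def by blast
  then show thesis
    using assms that unfolding left_principal_def by auto
qed

lemma left_annihilator_mono:
  "left_annihilator y \<subseteq> left_annihilator (y * s)"
  unfolding left_annihilator_def by (auto simp flip: mult.assoc)

lemma right_annihilator_mono:
  "right_annihilator y \<subseteq> right_annihilator (s * y)"
  unfolding right_annihilator_def by (auto simp: mult.assoc)

text \<open>Each element is a right multiple of the other, and multiplying on the right can only
  enlarge a left annihilator.\<close>

lemma left_annihilator_eq_if_right_principal_eq:
  assumes "right_principal x = right_principal y"
  shows "left_annihilator x = left_annihilator y"
  using assms by (metis left_annihilator_mono right_principal_eqE subset_antisym)

lemma right_annihilator_eq_if_left_principal_eq:
  assumes "left_principal x = left_principal y"
  shows "right_annihilator x = right_annihilator y"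
  using assms by (metis right_annihilator_mono left_principal_eqE subset_antisym)

lemma principal_ideals_of_w_core_inverse:
  fixes a w x :: "'a::star_monoid"
  assumes range: "a * w * x\<^sup>2 = x" and fixed: "x * a * w * a = a"
    and sym: "(a * w * x)\<^sup>\<star> = a * w * x"
  shows "right_principal x = right_principal a"
    and "left_principal x = left_principal (a\<^sup>\<star>)"
proof -
  note inner = w_core_inverse_identities[OF range fixed]
  have "x = a * (w * x\<^sup>2)"
    by (simp only: range flip: mult.assoc)
  moreover have "a = x * (a * w * a)"
    by (simp only: fixed flip: mult.assoc)
  ultimately show "right_principal x = right_principal a"
    by (rule right_principal_eqI)
  \<comment> \<open>Symmetry of \<open>a * w * x\<close> brings in the adjoint of \<open>a\<close>:
    the last three factors of \<open>x * a * w * x\<close> may be starred, and the star reverses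
    them so that the adjoint of \<open>a\<close> ends up on the right.\<close>
  have "(x * (w * x)\<^sup>\<star>) * a\<^sup>\<star> = x * (a * w * x)\<^sup>\<star>"
    by (simp only: star_mult mult.assoc)
  also have "\<dots> = x * a * w * x"
    by (simp only: sym) (simp only: mult.assoc)
  finally have "x = (x * (w * x)\<^sup>\<star>) * a\<^sup>\<star>"
    by (simp only: inner(2))
  \<comment> \<open>The converse factorization is the adjoint of \<open>a * w * x * a = a\<close>,
    with the star on \<open>a * w * x\<close> removed by symmetry.\<close>
  moreover have "(a\<^sup>\<star> * a * w) * x = a\<^sup>\<star> * (a * w * x)\<^sup>\<star>"
    by (simp only: sym) (simp only: mult.assoc)
  then have "a\<^sup>\<star> = (a\<^sup>\<star> * a * w) * x"
    by (simp only: inner(1) flip: star_mult)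
  ultimately show "left_principal x = left_principal (a\<^sup>\<star>)"
    by (rule left_principal_eqI)
qed

text \<open>Three transfers: \<open>a * w * x\<close> fixes \<open>a\<close> from the left, hence
  also \<open>x\<close>; its adjoint fixes the adjoint of \<open>a\<close> from the right, hence
  also \<open>x\<close>, which forces symmetry; finally \<open>x * a * w\<close> fixes
  \<open>x\<close> from the left, hence also \<open>a\<close>.\<close>

lemma w_core_inverse_if_annihilators:
  fixes a w x :: "'a::star_monoid"
  assumes inner: "a * w * x * a = a"
    and left: "left_annihilator x = left_annihilator a"
    and right: "right_annihilator (a\<^sup>\<star>) \<subseteq> right_annihilator x"
  shows "a * w * x\<^sup>2 = x" and "x * a * w * a = a" and "(a * w * x)\<^sup>\<star> = a * w * x"
proof -
  have "(a * w * x, 1) \<in> left_annihilator a"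
    by (simp add: left_annihilator_def inner)
  then have "(a * w * x, 1) \<in> left_annihilator x"
    by (simp only: left)
  then show "a * w * x\<^sup>2 = x"
    by (simp add: left_annihilator_def power2_eq_square mult.assoc)
  have "a\<^sup>\<star> * (a * w * x)\<^sup>\<star> = a\<^sup>\<star>"
    by (simp only: inner flip: star_mult)
  then have "((a * w * x)\<^sup>\<star>, 1) \<in> right_annihilator (a\<^sup>\<star>)"
    by (simp add: right_annihilator_def)
  then have "((a * w * x)\<^sup>\<star>, 1) \<in> right_annihilator x"
    using right by blast
  then have absorb: "x * (a * w * x)\<^sup>\<star> = x"
    by (simp add: right_annihilator_def)
  \<comment> \<open>\<open>p = p * p\<^sup>\<star>\<close> makes \<open>p = a * w * x\<close> symmetric.\<close>
  then have "a * w * x = (a * w * x) * (a * w * x)\<^sup>\<star>"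
    by (simp only: mult.assoc)
  then show sym: "(a * w * x)\<^sup>\<star> = a * w * x"
    by (metis star_mult star_star)
  \<comment> \<open>With symmetry known, \<open>absorb\<close> reads
    \<open>x * a * w * x = x\<close>; the equality of left annihilators is now used in the other
    direction, from \<open>x\<close> to \<open>a\<close>.\<close>
  have "(x * a * w, 1) \<in> left_annihilator x"
    using absorb by (simp add: left_annihilator_def sym flip: mult.assoc)
  then have "(x * a * w, 1) \<in> left_annihilator a"
    by (simp only: left)
  then show "x * a * w * a = a"
    by (simp add: left_annihilator_def)
qed

theorem theorem2p13:
  fixes a w :: "'a::star_monoid"
  defines "cond_i \<equiv> w_core_invertible w a"
    and "cond_ii \<equiv> \<exists>x. a * w * x * a = a \<and> x * a * w * x = x \<and>
          (a * w * x)\<^sup>\<star> = a * w * x \<and> x * a * w * a = a \<and> a * w * x\<^sup>2 = x"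
    and "cond_iii \<equiv> \<exists>x. a * w * x * a = a \<and>
          right_principal x = right_principal a \<and> left_principal x = left_principal (a\<^sup>\<star>)"
    and "cond_iv \<equiv> \<exists>x. a * w * x * a = a \<and>
          left_annihilator x = left_annihilator a \<and>
          right_annihilator x = right_annihilator (a\<^sup>\<star>)"
    and "cond_v \<equiv> \<exists>x. a * w * x * a = a \<and>
          left_annihilator x = left_annihilator a \<and>
          right_annihilator (a\<^sup>\<star>) \<subseteq> right_annihilator x"
  shows "(cond_i \<longleftrightarrow> cond_ii) \<and> (cond_i \<longleftrightarrow> cond_iii) \<and> (cond_i \<longleftrightarrow> cond_iv) \<and> (cond_i \<longleftrightarrow> cond_v)"
proof -
  \<comment> \<open>Five implications close the cycle, each reusing the \<open>x\<close> obtained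
    from the preceding condition.\<close>
  have "cond_ii" if cond_i: "cond_i"
  proof -
    obtain x where "a * w * x\<^sup>2 = x" "x * a * w * a = a" "(a * w * x)\<^sup>\<star> = a * w * x"
      using cond_i unfolding cond_i_def w_core_invertible_def by (elim exE conjE)
    with w_core_inverse_identities[OF this(1,2)] show ?thesis
      unfolding cond_ii_def by (intro exI[of _ x] conjI)
  qed
  moreover have "cond_iii" if cond_ii: "cond_ii"
  proof -
    obtain x where "a * w * x * a = a" "a * w * x\<^sup>2 = x" "x * a * w * a = a"
        "(a * w * x)\<^sup>\<star> = a * w * x"
      using cond_ii unfolding cond_ii_def by (elim exE conjE)
    with principal_ideals_of_w_core_inverse[OF this(2-4)] show ?thesis
      unfolding cond_iii_def by (intro exI[of _ x] conjI)
  qed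
  moreover have "cond_iv" if cond_iii: "cond_iii"
  proof -
    obtain x where x: "a * w * x * a = a" "right_principal x = right_principal a"
        "left_principal x = left_principal (a\<^sup>\<star>)"
      using cond_iii unfolding cond_iii_def by (elim exE conjE)
    with left_annihilator_eq_if_right_principal_eq[OF x(2)]
      right_annihilator_eq_if_left_principal_eq[OF x(3)]
    show ?thesis
      unfolding cond_iv_def by (intro exI[of _ x] conjI)
  qed
  moreover have "cond_v" if cond_iv: "cond_iv"
    using cond_iv unfolding cond_iv_def cond_v_def by (elim ex_forward) simp
  moreover have "cond_i" if cond_v: "cond_v"
  proof -
    obtain x where "a * w * x * a = a" "left_annihilator x = left_annihilator a"
        "right_annihilator (a\<^sup>\<star>) \<subseteq> right_annihilator x"
      using cond_v unfolding cond_v_def by (elim exE conjE)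
    from w_core_inverse_if_annihilators[OF this] show ?thesis
      unfolding cond_i_def w_core_invertible_def by (intro exI[of _ x] conjI)
  qed
  ultimately show ?thesis
    by iprover
qed

end
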